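(* Let $\mathrm{Rep}(O_t)$ denote Deligne's rigid symmetric monoidal interpolation category for the orthogonal series, presented as the Karoubi envelope of the additive envelope of the Brauer category $\mathcal{B}(t)$, and let $\mathsf{X}_t$ denote its standard generating object. Then $$\dim_{\mathrm{cat}}(\mathsf{X}_t)=t,$$ and consequently, for all real $x>0$ and $r\ge 0$, $$\frac{R(x,r)}{T(x,r)}=\frac{\dim_{\mathrm{cat}}(\mathsf{X}_{x+2r})}{\dim_{\mathrm{cat}}(\mathsf{X}_x)}.$$
   Context: Brauer category. Work over the ground field $\mathbb{C}$ and let $t\in\mathbb{C}$. The Brauer category $\mathcal{B}(t)$ is the $\mathbb{C}$-linear category with objects the nonnegative integers, where $\mathrm{Hom}(m,n)$ is the $\mathbb{C}$-vector space with basis the Brauer diagrams from $m$ to $n$, i.e. perfect matchings of a set of $m+n$ points ($m$ in a bottom row and $n$ in a top row). The composite of two diagrams is obtained by stacking them vertically, deleting the closed loops formed in the middle, and multiplying by $t$ for each deleted closed loop. The tensor product is $m\otimes n=m+n$ on objects and horizontal juxtaposition on diagrams, with unit object $\mathbf{1}=0$; the symmetry $m\otimes n\to n\otimes m$ is the diagram crossing the first $m$ strands over the last $n$ strands. The object $1$ is self-dual, with coevaluation $0\to 2$ and evaluation $2\to 0$ given by the unique Brauer diagrams (cup and cap); this makes $\mathcal{B}(t)$ a rigid symmetric monoidal category with $\mathrm{End}(\mathbf{1})=\mathbb{C}$. $\mathrm{Rep}(O_t)$ is the Karoubi (idempotent-completion) envelope of the additive envelope of $\mathcal{B}(t)$,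 with the induced rigid symmetric monoidal structure; $\mathsf{X}_t$ is the image in $\mathrm{Rep}(O_t)$ of the object $1$ of $\mathcal{B}(t)$. Categorical dimension. For an object $X$ of a rigid symmetric monoidal category, $\dim_{\mathrm{cat}}(X)\in\mathrm{End}(\mathbf{1})$ is the categorical trace of $\mathrm{id}_X$: the composite $\mathbf{1}\to X\otimes X^*\to X^*\otimes X\to\mathbf{1}$ of coevaluation, symmetry, and evaluation. The functions $R$ and $T$. For real $x>0$ let $\mathcal{M}(x)$ be the positive Radon measure on $(0,\infty)$ given by $d\mathcal{M}(x)(u)=\frac{\pi^{x/2}}{\Gamma(x/2)}\,u^{x/2-1}\,du$. For $x>0$, $r\ge 0$, the radial-integration cocycle is $R(x,r)=\pi^r\,\frac{\Gamma(x/2)}{\Gamma(x/2+r)}$ (the coefficient for which $u\mapsto R(x,r)u^r$ is the Radon--Nikodym density of $\mathcal{M}(x+2r)$ with respect to $\mathcal{M}(x)$). Put $V(x):=\mathcal{M}(x)\bigl((0,1)\bigr)$; the ball-volume cocycle is $T(x,r):=V(x+2r)/V(x)$. *)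

theory Defs
  imports "HOL-Analysis.Analysis" "HOL-Library.Function_Algebras"
begin

section \<open>Linear rigid symmetric monoidal categories\<close>

text \<open>
  The data of a complex-linear, strictly monoidal, rigid symmetric category. Every hom-set is
  a subset of one ambient additive group \<open>'m\<close> and shares its zero and addition; hom-sets need
  not be disjoint, so composition and the tensor product of morphisms take the objects
  involved as arguments.

  \<^item> \<open>comp_mor C X Y Z g f\<close> is the composite of \<open>f : X \<rightarrow> Y\<close> and \<open>g : Y \<rightarrow> Z\<close>;
  \<^item> \<open>tens C X X' Y Y' f g : X \<otimes> Y \<rightarrow> X' \<otimes> Y'\<close> for \<open>f : X \<rightarrow> X'\<close> and \<open>g : Y \<rightarrow> Y'\<close>;
  \<^item> \<open>symm C X Y : X \<otimes> Y \<rightarrow> Y \<otimes> X\<close>;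
  \<^item> \<open>coev C X : 1 \<rightarrow> X \<otimes> X*\<close> and \<open>ev C X : X* \<otimes> X \<rightarrow> 1\<close>.

  The three categories below are strict (the additive envelope because tensor products of
  lists of summands are ordered lexicographically), so no associators or unitors occur.
\<close>

record ('o, 'm) rsm_cat =
  obj :: "'o set"
  hom :: "'o \<Rightarrow> 'o \<Rightarrow> 'm set"
  ident :: "'o \<Rightarrow> 'm"
  comp_mor :: "'o \<Rightarrow> 'o \<Rightarrow> 'o \<Rightarrow> 'm \<Rightarrow> 'm \<Rightarrow> 'm"
  scale :: "complex \<Rightarrow> 'm \<Rightarrow> 'm"
  unit_obj :: "'o"
  tens_obj :: "'o \<Rightarrow> 'o \<Rightarrow> 'o"
  tens :: "'o \<Rightarrow> 'o \<Rightarrow> 'o \<Rightarrow> 'o \<Rightarrow> 'm \<Rightarrow> 'm \<Rightarrow> 'm"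
  symm :: "'o \<Rightarrow> 'o \<Rightarrow> 'm"
  dual :: "'o \<Rightarrow> 'o"
  ev :: "'o \<Rightarrow> 'm"
  coev :: "'o \<Rightarrow> 'm"

definition dim_cat :: "('o, 'm) rsm_cat \<Rightarrow> 'o \<Rightarrow> 'm" where
  "dim_cat C X =
     (let I = unit_obj C; X' = dual C X; P = tens_obj C X X'; Q = tens_obj C X' X
      in comp_mor C I Q I (ev C X) (comp_mor C I P Q (symm C X X') (coev C X)))"

text \<open>The endomorphism \<open>c \<cdot> id\<close> of the unit object, and the inverse identification of
  the endomorphisms of the unit object with complex numbers (meaningful when these
  endomorphisms form the line spanned by a nonzero identity).\<close>

definition end_unit_of :: "('o, 'm) rsm_cat \<Rightarrow> complex \<Rightarrow> 'm" where
  "end_unit_of C c = scale C c (ident C (unit_obj C))"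

definition end_unit_scalar :: "('o, 'm) rsm_cat \<Rightarrow> 'm \<Rightarrow> complex" where
  "end_unit_scalar C f = (THE c. f = end_unit_of C c)"


section \<open>Brauer diagrams\<close>

datatype pt = Bot nat | Top nat

definition brauer_points :: "nat \<Rightarrow> nat \<Rightarrow> pt set" where
  "brauer_points m n = Bot ` {..<m} \<union> Top ` {..<n}"

definition brauer_diagrams :: "nat \<Rightarrow> nat \<Rightarrow> pt set set set" where
  "brauer_diagrams m n = {D. partition_on (brauer_points m n) D \<and> (\<forall>b\<in>D. card b = 2)}"

text \<open>Points of two stacked diagrams: bottom row, identified middle rows, top row.\<close>

datatype stack_pt = Lo nat | Mid nat | Hi nat

fun lower :: "pt \<Rightarrow> stack_pt" where
  "lower (Bot i) = Lo i"
| "lower (Top i) = Mid i"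

fun upper :: "pt \<Rightarrow> stack_pt" where
  "upper (Bot i) = Mid i"
| "upper (Top i) = Hi i"

definition stack :: "pt set set \<Rightarrow> pt set set \<Rightarrow> stack_pt set set" where
  "stack D E = (`) lower ` D \<union> (`) upper ` E"

definition components :: "'a set set \<Rightarrow> 'a set set" where
  "components S = \<Union>S // {(x, y). \<exists>e\<in>S. x \<in> e \<and> y \<in> e}\<^sup>*"

definition outer :: "stack_pt set \<Rightarrow> pt set" where
  "outer K = Bot ` {i. Lo i \<in> K} \<union> Top ` {i. Hi i \<in> K}"

text \<open>\<open>D\<close> is the lower and \<open>E\<close> the upper diagram. A component of the stack is either an arc
  with two outer end points or a closed loop, which has no outer points.\<close>

definition stack_diagram :: "pt set set \<Rightarrow> pt set set \<Rightarrow> pt set set" where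
  "stack_diagram D E = outer ` components (stack D E) - {{}}"

definition stack_loops :: "pt set set \<Rightarrow> pt set set \<Rightarrow> nat" where
  "stack_loops D E = card {K \<in> components (stack D E). outer K = {}}"

fun shift_pt :: "nat \<Rightarrow> nat \<Rightarrow> pt \<Rightarrow> pt" where
  "shift_pt m n (Bot i) = Bot (m + i)"
| "shift_pt m n (Top i) = Top (n + i)"

definition juxtapose :: "nat \<Rightarrow> nat \<Rightarrow> pt set set \<Rightarrow> pt set set \<Rightarrow> pt set set" where
  "juxtapose m n D E = D \<union> (`) (shift_pt m n) ` E"

definition id_diagram :: "nat \<Rightarrow> pt set set" where
  "id_diagram m = (\<lambda>i. {Bot i, Top i}) ` {..<m}"

definition cross_diagram :: "nat \<Rightarrow> nat \<Rightarrow> pt set set" where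
  "cross_diagram m n =
     (\<lambda>i. {Bot i, Top (n + i)}) ` {..<m} \<union> (\<lambda>j. {Bot (m + j), Top j}) ` {..<n}"

text \<open>For \<open>m = 1\<close> these are the unique diagrams \<open>2 \<rightarrow> 0\<close> and \<open>0 \<rightarrow> 2\<close>.\<close>

definition ev_diagram :: "nat \<Rightarrow> pt set set" where
  "ev_diagram m = (\<lambda>i. {Bot i, Bot (m + i)}) ` {..<m}"

definition coev_diagram :: "nat \<Rightarrow> pt set set" where
  "coev_diagram m = (\<lambda>i. {Top i, Top (m + i)}) ` {..<m}"


section \<open>The Brauer category\<close>

text \<open>A morphism is the family of its coefficients with respect to the basis of diagrams.\<close>

type_synonym brauer_mor = "pt set set \<Rightarrow> complex"

definition basis_mor :: "pt set set \<Rightarrow> brauer_mor" where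
  "basis_mor D = (\<lambda>F. if F = D then 1 else 0)"

definition brauer_comp ::
    "complex \<Rightarrow> nat \<Rightarrow> nat \<Rightarrow> nat \<Rightarrow> brauer_mor \<Rightarrow> brauer_mor \<Rightarrow> brauer_mor" where
  "brauer_comp t m n p g f =
     (\<lambda>F. \<Sum>D\<in>brauer_diagrams m n. \<Sum>E\<in>brauer_diagrams n p.
        g E * f D * t ^ stack_loops D E * basis_mor (stack_diagram D E) F)"

definition brauer_tens ::
    "nat \<Rightarrow> nat \<Rightarrow> nat \<Rightarrow> nat \<Rightarrow> brauer_mor \<Rightarrow> brauer_mor \<Rightarrow> brauer_mor" where
  "brauer_tens m m' n n' f g =
     (\<lambda>F. \<Sum>D\<in>brauer_diagrams m m'. \<Sum>E\<in>brauer_diagrams n n'.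
        f D * g E * basis_mor (juxtapose m m' D E) F)"

definition brauer_cat :: "complex \<Rightarrow> (nat, brauer_mor) rsm_cat" where
  "brauer_cat t =
    \<lparr>obj = UNIV,
     hom = (\<lambda>m n. {f. \<forall>D. D \<notin> brauer_diagrams m n \<longrightarrow> f D = 0}),
     ident = (\<lambda>m. basis_mor (id_diagram m)),
     comp_mor = brauer_comp t,
     scale = (\<lambda>c f D. c * f D),
     unit_obj = 0,
     tens_obj = (+),
     tens = brauer_tens,
     symm = (\<lambda>m n. basis_mor (cross_diagram m n)),
     dual = (\<lambda>m. m),
     ev = (\<lambda>m. basis_mor (ev_diagram m)),
     coev = (\<lambda>m. basis_mor (coev_diagram m))\<rparr>"


section \<open>Additive envelope\<close>

text \<open>
  Objects are finite lists of objects (formal direct sums). A morphism from \<open>Xs\<close> to \<open>Ys\<close> is a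
  matrix \<open>M\<close> with \<open>M i j : Xs ! j \<rightarrow> Ys ! i\<close>, which is zero outside the index range. The
  summand \<open>Xs ! a \<otimes> Ys ! b\<close> of \<open>Xs \<otimes> Ys\<close> has index \<open>a * length Ys + b\<close>.
\<close>

definition mat_of :: "nat \<Rightarrow> nat \<Rightarrow> (nat \<Rightarrow> nat \<Rightarrow> 'm::zero) \<Rightarrow> nat \<Rightarrow> nat \<Rightarrow> 'm" where
  "mat_of r c M = (\<lambda>i j. if i < r \<and> j < c then M i j else 0)"

definition add_tens_obj :: "('o, 'm) rsm_cat \<Rightarrow> 'o list \<Rightarrow> 'o list \<Rightarrow> 'o list" where
  "add_tens_obj C Xs Ys = concat (map (\<lambda>X. map (\<lambda>Y. tens_obj C X Y) Ys) Xs)"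

definition additive_envelope ::
    "('o, 'm::ab_group_add) rsm_cat \<Rightarrow> ('o list, nat \<Rightarrow> nat \<Rightarrow> 'm) rsm_cat" where
  "additive_envelope C =
    \<lparr>obj = {Xs. set Xs \<subseteq> obj C},
     hom = (\<lambda>Xs Ys. {M. \<forall>i j. if i < length Ys \<and> j < length Xs
                              then M i j \<in> hom C (Xs ! j) (Ys ! i) else M i j = 0}),
     ident = (\<lambda>Xs. mat_of (length Xs) (length Xs)
                (\<lambda>i j. if i = j then ident C (Xs ! i) else 0)),
     comp_mor = (\<lambda>Xs Ys Zs N M. mat_of (length Zs) (length Xs)
                (\<lambda>i j. \<Sum>k<length Ys. comp_mor C (Xs ! j) (Ys ! k) (Zs ! i) (N i k) (M k j))),
     scale = (\<lambda>c M i j. scale C c (M i j)),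
     unit_obj = [unit_obj C],
     tens_obj = add_tens_obj C,
     tens = (\<lambda>Xs Xs' Ys Ys' M N.
                mat_of (length Xs' * length Ys') (length Xs * length Ys)
                (\<lambda>i j. let a = j div length Ys; b = j mod length Ys;
                           a' = i div length Ys'; b' = i mod length Ys'
                       in tens C (Xs ! a) (Xs' ! a') (Ys ! b) (Ys' ! b') (M a' a) (N b' b))),
     symm = (\<lambda>Xs Ys. mat_of (length Ys * length Xs) (length Xs * length Ys)
                (\<lambda>i j. let a = j div length Ys; b = j mod length Ys
                       in if i = b * length Xs + a then symm C (Xs ! a) (Ys ! b) else 0)),
     dual = map (dual C),
     ev = (\<lambda>Xs. mat_of 1 (length Xs * length Xs)
                (\<lambda>i j. let a = j div length Xs; b = j mod length Xs
                       in if a = b then ev C (Xs ! a) else 0)),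
     coev = (\<lambda>Xs. mat_of (length Xs * length Xs) 1
                (\<lambda>i j. let a = i div length Xs; b = i mod length Xs
                       in if a = b then coev C (Xs ! a) else 0))\<rparr>"


section \<open>Karoubi envelope\<close>

text \<open>
  The transpose \<open>f* : Y* \<rightarrow> X*\<close> of \<open>f : X \<rightarrow> Y\<close>, that is, the composite
  \<open>Y* \<rightarrow> Y* \<otimes> X \<otimes> X* \<rightarrow> Y* \<otimes> Y \<otimes> X* \<rightarrow> X*\<close> of \<open>id \<otimes> coev\<close>, \<open>id \<otimes> f \<otimes> id\<close> and \<open>ev \<otimes> id\<close>.
\<close>

definition transpose_mor :: "('o, 'm) rsm_cat \<Rightarrow> 'o \<Rightarrow> 'o \<Rightarrow> 'm \<Rightarrow> 'm" where
  "transpose_mor C X Y f =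
     (let I = unit_obj C; X' = dual C X; Y' = dual C Y;
          YX = tens_obj C Y' X; YY = tens_obj C Y' Y; XX = tens_obj C X X';
          P = tens_obj C YX X'; Q = tens_obj C YY X'
      in comp_mor C Y' Q X'
           (tens C YY I X' X' (ev C Y) (ident C X'))
           (comp_mor C Y' P Q
             (tens C YX YY X' X' (tens C Y' Y' X Y (ident C Y') f) (ident C X'))
             (tens C Y' Y' I XX (ident C Y') (coev C X))))"

text \<open>
  Objects are pairs \<open>(X, e)\<close> with \<open>e\<close> an idempotent endomorphism of \<open>X\<close>. The structure
  morphisms are those of the original category, cut down by the idempotents.
\<close>

definition karoubi_envelope :: "('o, 'm) rsm_cat \<Rightarrow> ('o \<times> 'm, 'm) rsm_cat" where
  "karoubi_envelope C =
    \<lparr>obj = {(X, e). X \<in> obj C \<and> e \<in> hom C X X \<and> comp_mor C X X X e e = e},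
     hom = (\<lambda>(X, e) (Y, f). {h \<in> hom C X Y. comp_mor C X Y Y f (comp_mor C X X Y h e) = h}),
     ident = (\<lambda>(X, e). e),
     comp_mor = (\<lambda>(X, _) (Y, _) (Z, _). comp_mor C X Y Z),
     scale = scale C,
     unit_obj = (unit_obj C, ident C (unit_obj C)),
     tens_obj = (\<lambda>(X, e) (Y, f). (tens_obj C X Y, tens C X X Y Y e f)),
     tens = (\<lambda>(X, _) (X', _) (Y, _) (Y', _). tens C X X' Y Y'),
     symm = (\<lambda>(X, e) (Y, f).
               let P = tens_obj C X Y in
               comp_mor C P P (tens_obj C Y X) (symm C X Y) (tens C X X Y Y e f)),
     dual = (\<lambda>(X, e). (dual C X, transpose_mor C X X e)),
     ev = (\<lambda>(X, e). let X' = dual C X; P = tens_obj C X' X in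
               comp_mor C P P (unit_obj C) (ev C X)
                 (tens C X' X' X X (transpose_mor C X X e) e)),
     coev = (\<lambda>(X, e). let X' = dual C X; P = tens_obj C X X' in
               comp_mor C (unit_obj C) P P
                 (tens C X X X' X' e (transpose_mor C X X e)) (coev C X))\<rparr>"


section \<open>Deligne's category and its generating object\<close>

definition RepO ::
    "complex \<Rightarrow> (nat list \<times> (nat \<Rightarrow> nat \<Rightarrow> brauer_mor), nat \<Rightarrow> nat \<Rightarrow> brauer_mor) rsm_cat" where
  "RepO t = karoubi_envelope (additive_envelope (brauer_cat t))"

definition RepO_of_brauer :: "complex \<Rightarrow> nat \<Rightarrow> nat list \<times> (nat \<Rightarrow> nat \<Rightarrow> brauer_mor)" where
  "RepO_of_brauer t m = ([m], ident (additive_envelope (brauer_cat t)) [m])"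

definition X_gen :: "complex \<Rightarrow> nat list \<times> (nat \<Rightarrow> nat \<Rightarrow> brauer_mor)" where
  "X_gen t = RepO_of_brauer t 1"


section \<open>Radial integration and ball volume cocycles\<close>

definition radial_measure :: "real \<Rightarrow> real measure" where
  "radial_measure x =
     density (restrict_space lborel {0<..})
       (\<lambda>u. ennreal (pi powr (x / 2) / Gamma (x / 2) * u powr (x / 2 - 1)))"

definition R_cocycle :: "real \<Rightarrow> real \<Rightarrow> real" where
  "R_cocycle x r = pi powr r * (Gamma (x / 2) / Gamma (x / 2 + r))"

definition V_ball :: "real \<Rightarrow> real" where
  "V_ball x = measure (radial_measure x) {0<..<1}"

definition T_cocycle :: "real \<Rightarrow> real \<Rightarrow> real" where
  "T_cocycle x r = V_ball (x + 2 * r) / V_ball x"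

end

theory Submission
  imports Defs
begin

text \<open>
  The dimension of the object \<open>m\<close> of the Brauer category is the closure of \<open>m\<close> strands, which
  consists of \<open>m\<close> loops and hence equals \<open>t ^ m\<close>. On one-term lists, the additive envelope computes
  with the single matrix entry as in the Brauer category. The Karoubi envelope cuts evaluation,
  coevaluation and symmetry down by the idempotent and its transpose; for the identity, the
  transpose is the identity by the zigzag relation, so the cutting down has no effect. On the
  analytic side, \<open>V x = \<pi> powr (x/2) / \<Gamma>(x/2) * 2/x\<close>, so \<open>R / T\<close> is the quotient of \<open>x + 2 r\<close> and \<open>x\<close>.
\<close>

section \<open>Components of a set of edges\<close>

text \<open>The relation inside \<open>components\<close>. It is symmetric, so its reflexive
  transitive closure is an equivalence relation and paths can be reversed.\<close>

definition edge_rel :: "'a set set \<Rightarrow> ('a \<times> 'a) set" where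
  "edge_rel S = {(x, y). \<exists>e\<in>S. x \<in> e \<and> y \<in> e}"

lemma edge_relI: "e \<in> S \<Longrightarrow> x \<in> e \<Longrightarrow> y \<in> e \<Longrightarrow> (x, y) \<in> edge_rel S"
  by (auto simp: edge_rel_def)

lemma sym_edge_rel: "sym (edge_rel S)"
  by (auto simp: edge_rel_def sym_def)

text \<open>A certificate for a list of components: no edge leaves a \<open>K i\<close>, so these
  disjoint sets are unions of components, and paths from the anchor \<open>a i\<close> make each a
  single one. Every stack below is treated this way.\<close>

lemma components_eq_image:
  assumes cover: "\<Union>S = (\<Union>i\<in>I. K i)"
    and disj: "\<And>i j x. i \<in> I \<Longrightarrow> j \<in> I \<Longrightarrow> x \<in> K i \<Longrightarrow> x \<in> K j \<Longrightarrow> i = j"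
    and edges: "\<And>e. e \<in> S \<Longrightarrow> \<exists>i\<in>I. e \<subseteq> K i"
    and anchor: "\<And>i. i \<in> I \<Longrightarrow> a i \<in> K i"
    and conn: "\<And>i x. i \<in> I \<Longrightarrow> x \<in> K i \<Longrightarrow> (a i, x) \<in> (edge_rel S)\<^sup>*"
  shows "components S = K ` I"
proof -
  have cls: "(edge_rel S)\<^sup>* `` {x} = K i" if i: "i \<in> I" "x \<in> K i" for i x
  proof
    show "(edge_rel S)\<^sup>* `` {x} \<subseteq> K i"
    proof
      fix y assume "y \<in> (edge_rel S)\<^sup>* `` {x}"
      then have "(x, y) \<in> (edge_rel S)\<^sup>*" by simp
      then show "y \<in> K i"
      proof (induction rule: rtrancl_induct)
        case base
        show ?case by (fact i(2))
      next
        case (step y z)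
        then obtain e where e: "e \<in> S" "y \<in> e" "z \<in> e" by (auto simp: edge_rel_def)
        with edges obtain j where j: "j \<in> I" "e \<subseteq> K j" by blast
        \<comment> \<open>The edge lies in a single \<open>K j\<close>, and its end \<open>y\<close>
          is already in \<open>K i\<close>, so the path stays in the same set.\<close>
        with disj[OF i(1) j(1) step.IH] e have "i = j" by blast
        with e j show ?case by blast
      qed
    qed
    show "K i \<subseteq> (edge_rel S)\<^sup>* `` {x}"
    proof
      fix y assume "y \<in> K i"
      have "(x, a i) \<in> (edge_rel S)\<^sup>*"
        using conn[OF i] sym_rtrancl[OF sym_edge_rel] by (meson symD)
      also have "(a i, y) \<in> (edge_rel S)\<^sup>*" using conn i(1) \<open>y \<in> K i\<close> .
      finally show "y \<in> (edge_rel S)\<^sup>* `` {x}" by simp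
    qed
  qed
  have "components S = (\<lambda>x. (edge_rel S)\<^sup>* `` {x}) ` (\<Union>i\<in>I. K i)"
    unfolding components_def cover edge_rel_def by (auto simp: quotient_def)
  also have "\<dots> = K ` I"
  proof (intro equalityI subsetI)
    fix B assume "B \<in> (\<lambda>x. (edge_rel S)\<^sup>* `` {x}) ` (\<Union>i\<in>I. K i)"
    then show "B \<in> K ` I" using cls by blast
  next
    fix B assume "B \<in> K ` I"
    then obtain i where "i \<in> I" "B = K i" by blast
    then have "a i \<in> (\<Union>i\<in>I. K i)" "B = (edge_rel S)\<^sup>* `` {a i}"
      using cls[OF _ anchor] anchor by blast+
    then show "B \<in> (\<lambda>x. (edge_rel S)\<^sup>* `` {x}) ` (\<Union>i\<in>I. K i)" by blast
  qed
  finally show ?thesis .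
qed

section \<open>Composition and juxtaposition of Brauer diagrams\<close>

lemma finite_brauer_diagrams [simp]: "finite (brauer_diagrams m n)"
proof -
  have "brauer_diagrams m n \<subseteq> Pow (Pow (brauer_points m n))"
    by (auto simp: brauer_diagrams_def partition_on_def)
  moreover have "finite (brauer_points m n)" by (simp add: brauer_points_def)
  ultimately show ?thesis by (meson finite_Pow_iff finite_subset)
qed

text \<open>Each arc is given by its two ends \<open>p i\<close> and \<open>q i\<close>. No point is
  used twice, because the ends of each kind are distinct and the two kinds do not meet.\<close>

lemma brauer_diagrams_image:
  assumes cover: "(\<Union>i\<in>I. {p i, q i}) = brauer_points m n"
    and inj: "inj_on p I" "inj_on q I"
    and ne: "p ` I \<inter> q ` I = {}"
  shows "(\<lambda>i. {p i, q i}) ` I \<in> brauer_diagrams m n"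
proof -
  have pq: "p i \<noteq> q j" if "i \<in> I" "j \<in> I" for i j
    using ne that by blast
  have "i = j" if "i \<in> I" "j \<in> I" "{p i, q i} \<inter> {p j, q j} \<noteq> {}" for i j
    using that inj_onD[OF inj(1)] inj_onD[OF inj(2)] pq by (metis disjoint_insert(1) inf_bot_right insertE insert_disjoint(1) singletonD)
  then have "disjoint ((\<lambda>i. {p i, q i}) ` I)"
    unfolding disjoint_def by blast
  moreover have "card {p i, q i} = 2" if "i \<in> I" for i
    using pq[OF that that] by simp
  ultimately show ?thesis
    using cover by (auto simp: brauer_diagrams_def partition_on_def)
qed

lemma Union_brauer_diagram: "D \<in> brauer_diagrams m n \<Longrightarrow> \<Union>D = brauer_points m n"
  by (simp add: brauer_diagrams_def partition_on_def)

lemma lessThan_add_image: "{..<m + n} = {..<m} \<union> (+) m ` {..<n}" for m n :: nat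
proof -
  have "i \<in> (+) m ` {..<n}" if "\<not> i < m" "i < m + n" for i
    using that by (intro image_eqI[of _ _ "i - m"]) auto
  then show ?thesis by auto
qed

lemma id_diagram_in [simp]: "id_diagram m \<in> brauer_diagrams m m"
  unfolding id_diagram_def
  by (rule brauer_diagrams_image) (auto simp: brauer_points_def inj_on_def)

lemma ev_diagram_in [simp]: "ev_diagram m \<in> brauer_diagrams (m + m) 0"
  unfolding ev_diagram_def
  by (rule brauer_diagrams_image)
     (auto simp: brauer_points_def inj_on_def lessThan_add_image)

lemma coev_diagram_in [simp]: "coev_diagram m \<in> brauer_diagrams 0 (m + m)"
  unfolding coev_diagram_def
  by (rule brauer_diagrams_image)
     (auto simp: brauer_points_def inj_on_def lessThan_add_image)

lemma inj_shift_pt [simp]: "inj (shift_pt m n)"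
proof (rule injI)
  fix x y assume "shift_pt m n x = shift_pt m n y"
  then show "x = y" by (cases x; cases y) auto
qed

lemma brauer_points_add:
  "brauer_points (m + m') (n + n') = brauer_points m n \<union> shift_pt m n ` brauer_points m' n'"
  by (auto simp: brauer_points_def lessThan_add_image image_Un image_image)

lemma brauer_points_shift_disjoint:
  "brauer_points m n \<inter> shift_pt m n ` brauer_points m' n' = {}"
  by (auto simp: brauer_points_def)

lemma partition_on_Un:
  assumes "partition_on A P" "partition_on B Q" "A \<inter> B = {}"
  shows "partition_on (A \<union> B) (P \<union> Q)"
  using assms disjoint_union[of P Q] by (simp add: partition_on_def)

text \<open>The shift is injective and moves the second diagram onto points disjoint from those of
  the first, so two partitions are joined and block sizes are kept.\<close>

lemma juxtapose_in [simp]: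
  assumes D: "D \<in> brauer_diagrams m n" and E: "E \<in> brauer_diagrams m' n'"
  shows "juxtapose m n D E \<in> brauer_diagrams (m + m') (n + n')"
proof -
  have "partition_on (shift_pt m n ` brauer_points m' n') ((`) (shift_pt m n) ` E)"
  proof -
    have "partition_on (brauer_points m' n') E" using E by (simp add: brauer_diagrams_def)
    from partition_on_inj_image[OF this inj_on_subset[OF inj_shift_pt subset_UNIV]]
    have "partition_on (shift_pt m n ` brauer_points m' n') ((`) (shift_pt m n) ` E - {{}})" .
    \<comment> \<open>Blocks have two points, so removing the empty block changes nothing.\<close>
    moreover have "{} \<notin> (`) (shift_pt m n) ` E" using E by (auto simp: brauer_diagrams_def)
    ultimately show ?thesis by simp
  qed
  moreover have "partition_on (brauer_points m n) D" using D by (simp add: brauer_diagrams_def)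
  ultimately have "partition_on (brauer_points (m + m') (n + n')) (juxtapose m n D E)"
    unfolding brauer_points_add juxtapose_def
    by (intro partition_on_Un brauer_points_shift_disjoint)
  moreover have "card (shift_pt m n ` b) = card b" for b
    by (rule card_image) (rule inj_on_subset[OF inj_shift_pt subset_UNIV])
  ultimately show ?thesis
    using D E by (auto simp: brauer_diagrams_def juxtapose_def)
qed

lemma juxtapose_id [simp]: "juxtapose m m (id_diagram m) (id_diagram n) = id_diagram (m + n)"
  by (auto simp: juxtapose_def id_diagram_def lessThan_add_image image_Un image_image)

lemma cross_diagram_in [simp]: "cross_diagram m n \<in> brauer_diagrams (m + n) (n + m)"
proof -
  \<comment> \<open>Both families of strands are indexed by their bottom point: the strand from
    \<open>Bot (m + j)\<close> ends at \<open>Top j\<close>, hence \<open>i - m\<close>.\<close>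
  let ?q = "\<lambda>i. if i < m then Top (n + i) else Top (i - m)"
  have "cross_diagram m n = (\<lambda>i. {Bot i, ?q i}) ` {..<m + n}"
    by (auto simp: cross_diagram_def lessThan_add_image image_Un image_image)
  moreover have "(\<lambda>i. {Bot i, ?q i}) ` {..<m + n} \<in> brauer_diagrams (m + n) (n + m)"
    by (rule brauer_diagrams_image)
       (auto simp: brauer_points_def inj_on_def lessThan_add_image image_Un split: if_splits)
  ultimately show ?thesis by simp
qed

section \<open>Stacking with an identity diagram\<close>

lemma stack_rel_lower:
  "b \<in> D \<Longrightarrow> x \<in> b \<Longrightarrow> y \<in> b \<Longrightarrow> (lower x, lower y) \<in> edge_rel (stack D E)"
  by (rule edge_relI[of "lower ` b"]) (auto simp: stack_def)

lemma stack_rel_upper: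
  "b \<in> E \<Longrightarrow> x \<in> b \<Longrightarrow> y \<in> b \<Longrightarrow> (upper x, upper y) \<in> edge_rel (stack D E)"
  by (rule edge_relI[of "upper ` b"]) (auto simp: stack_def)

lemma Union_stack: "\<Union>(stack D E) = lower ` \<Union>D \<union> upper ` \<Union>E"
  by (auto simp: stack_def)

lemma block_nonempty: "D \<in> brauer_diagrams m n \<Longrightarrow> b \<in> D \<Longrightarrow> b \<noteq> {}"
  by (auto simp: brauer_diagrams_def)

lemma block_subset: "D \<in> brauer_diagrams m n \<Longrightarrow> b \<in> D \<Longrightarrow> b \<subseteq> brauer_points m n"
  by (auto simp: brauer_diagrams_def partition_on_def)

lemma block_unique:
  "D \<in> brauer_diagrams m n \<Longrightarrow> b \<in> D \<Longrightarrow> c \<in> D \<Longrightarrow> x \<in> b \<Longrightarrow> x \<in> c \<Longrightarrow> b = c"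
  by (auto simp: brauer_diagrams_def partition_on_def disjoint_def)

text \<open>The component grown from the block \<open>b\<close> of a lower diagram when an identity
  is stacked on top: each top point is continued to the upper row. \<open>extend_down\<close> is the
  mirror image.\<close>

definition extend_up :: "pt set \<Rightarrow> stack_pt set" where
  "extend_up b = lower ` b \<union> Hi ` {i. Top i \<in> b}"

definition extend_down :: "pt set \<Rightarrow> stack_pt set" where
  "extend_down b = upper ` b \<union> Lo ` {i. Bot i \<in> b}"

lemma lower_eq_iff:
  "lower x = Lo i \<longleftrightarrow> x = Bot i" "lower x = Mid i \<longleftrightarrow> x = Top i" "lower x \<noteq> Hi i"
  by (cases x; simp)+

lemma upper_eq_iff:
  "upper x \<noteq> Lo i" "upper x = Mid i \<longleftrightarrow> x = Bot i" "upper x = Hi i \<longleftrightarrow> x = Top i"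
  by (cases x; simp)+

lemma in_extend_up [simp]:
  "Lo i \<in> extend_up b \<longleftrightarrow> Bot i \<in> b"
  "Mid i \<in> extend_up b \<longleftrightarrow> Top i \<in> b"
  "Hi i \<in> extend_up b \<longleftrightarrow> Top i \<in> b"
  by (auto simp: extend_up_def image_iff lower_eq_iff eq_commute[of _ "lower _"])

lemma in_extend_down [simp]:
  "Lo i \<in> extend_down b \<longleftrightarrow> Bot i \<in> b"
  "Mid i \<in> extend_down b \<longleftrightarrow> Bot i \<in> b"
  "Hi i \<in> extend_down b \<longleftrightarrow> Top i \<in> b"
  by (auto simp: extend_down_def image_iff upper_eq_iff eq_commute[of _ "upper _"])

lemma outer_extend [simp]: "outer (extend_up b) = b" "outer (extend_down b) = b"
proof -
  have "Bot ` {i. Bot i \<in> b} \<union> Top ` {i. Top i \<in> b} = b"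
    by (auto simp: image_iff) (metis pt.exhaust)
  then show "outer (extend_up b) = b" "outer (extend_down b) = b"
    by (simp_all add: outer_def)
qed

text \<open>A strand of the identity meets the lower diagram in one point only, so it lengthens a
  block but neither joins two blocks nor closes a loop.\<close>

lemma components_stack_id:
  assumes D: "D \<in> brauer_diagrams m n"
  shows "components (stack D (id_diagram n)) = extend_up ` D"
proof (rule components_eq_image[where a = "\<lambda>b. lower (SOME x. x \<in> b)"])
  let ?S = "stack D (id_diagram n)"
  have some: "(SOME x. x \<in> b) \<in> b" if "b \<in> D" for b
    using block_nonempty[OF D that] by (simp add: some_in_eq)
  have top: "i < n" if "b \<in> D" "Top i \<in> b" for b i
    using block_subset[OF D that(1)] that(2) by (auto simp: brauer_points_def)
  have cov: "\<exists>b\<in>D. Top i \<in> b" if "i < n" for i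
    using Union_brauer_diagram[OF D] that by (auto simp: brauer_points_def)
  have U: "\<Union>(id_diagram n) = Bot ` {..<n} \<union> Top ` {..<n}" 
    by (auto simp: id_diagram_def)
  have "(\<Union>b\<in>D. extend_up b) = lower ` \<Union>D \<union> Hi ` {i. Top i \<in> \<Union>D}"
    unfolding extend_up_def by blast
  then show "\<Union>?S = (\<Union>b\<in>D. extend_up b)"
    unfolding Union_stack U Union_brauer_diagram[OF D]
    by (auto simp: brauer_points_def image_Un image_image)
  show "b = c" if "b \<in> D" "c \<in> D" "x \<in> extend_up b" "x \<in> extend_up c" for b c x
    using that block_unique[OF D that(1,2)] by (cases x) auto
  show "\<exists>b\<in>D. e \<subseteq> extend_up b" if "e \<in> ?S" for e
    using that unfolding stack_def
  proof (elim UnE imageE)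
    fix b assume "b \<in> D" "e = lower ` b"
    then show ?thesis using cov by (auto simp: extend_up_def)
  next
    fix b assume "b \<in> id_diagram n" "e = upper ` b"
    then show ?thesis using cov by (auto simp: id_diagram_def)
  qed
  show "lower (SOME x. x \<in> b) \<in> extend_up b" if "b \<in> D" for b
    using some[OF that] by (auto simp: extend_up_def)
  show "(lower (SOME x. x \<in> b), x) \<in> (edge_rel ?S)\<^sup>*" if b: "b \<in> D" and x: "x \<in> extend_up b" for b x
    using x unfolding extend_up_def
  proof (elim UnE imageE)
    fix y assume "x = lower y" "y \<in> b"
    then show ?thesis using stack_rel_lower[OF b some[OF b]] by auto
  next
    fix i assume i: "x = Hi i" "i \<in> {i. Top i \<in> b}"
    \<comment> \<open>The upper row is reached in two edges: within the block to the middle row,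
      then along the identity strand.\<close>
    then have "(lower (SOME x. x \<in> b), lower (Top i)) \<in> edge_rel ?S"
      by (intro stack_rel_lower[OF b some[OF b]]) simp
    moreover have "(upper (Bot i), upper (Top i)) \<in> edge_rel ?S"
      using i top[OF b] by (intro stack_rel_upper[of "{Bot i, Top i}"]) (auto simp: id_diagram_def)
    ultimately show ?thesis using i by simp
  qed
qed

lemma components_id_stack:
  assumes D: "D \<in> brauer_diagrams m n"
  shows "components (stack (id_diagram m) D) = extend_down ` D"
proof (rule components_eq_image[where a = "\<lambda>b. upper (SOME x. x \<in> b)"])
  let ?S = "stack (id_diagram m) D"
  have some: "(SOME x. x \<in> b) \<in> b" if "b \<in> D" for b
    using block_nonempty[OF D that] by (simp add: some_in_eq)
  have bot: "i < m" if "b \<in> D" "Bot i \<in> b" for b i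
    using block_subset[OF D that(1)] that(2) by (auto simp: brauer_points_def)
  have cov: "\<exists>b\<in>D. Bot i \<in> b" if "i < m" for i
    using Union_brauer_diagram[OF D] that by (auto simp: brauer_points_def)
  have U: "\<Union>(id_diagram m) = Bot ` {..<m} \<union> Top ` {..<m}" 
    by (auto simp: id_diagram_def)
  have "(\<Union>b\<in>D. extend_down b) = upper ` \<Union>D \<union> Lo ` {i. Bot i \<in> \<Union>D}"
    unfolding extend_down_def by blast
  then show "\<Union>?S = (\<Union>b\<in>D. extend_down b)"
    unfolding Union_stack U Union_brauer_diagram[OF D]
    by (auto simp: brauer_points_def image_Un image_image)
  show "b = c" if "b \<in> D" "c \<in> D" "x \<in> extend_down b" "x \<in> extend_down c" for b c x
    using that block_unique[OF D that(1,2)] by (cases x) auto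
  show "\<exists>b\<in>D. e \<subseteq> extend_down b" if "e \<in> ?S" for e
    using that unfolding stack_def
  proof (elim UnE imageE)
    fix b assume "b \<in> id_diagram m" "e = lower ` b"
    then show ?thesis using cov by (auto simp: id_diagram_def)
  next
    fix b assume "b \<in> D" "e = upper ` b"
    then show ?thesis using cov by (auto simp: extend_down_def)
  qed
  show "upper (SOME x. x \<in> b) \<in> extend_down b" if "b \<in> D" for b
    using some[OF that] by (auto simp: extend_down_def)
  show "(upper (SOME x. x \<in> b), x) \<in> (edge_rel ?S)\<^sup>*" if b: "b \<in> D" and x: "x \<in> extend_down b" for b x
    using x unfolding extend_down_def
  proof (elim UnE imageE)
    fix y assume "x = upper y" "y \<in> b"
    then show ?thesis using stack_rel_upper[OF b some[OF b]] by auto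
  next
    fix i assume i: "x = Lo i" "i \<in> {i. Bot i \<in> b}"
    then have "(upper (SOME x. x \<in> b), upper (Bot i)) \<in> edge_rel ?S"
      by (intro stack_rel_upper[OF b some[OF b]]) simp
    moreover have "(lower (Top i), lower (Bot i)) \<in> edge_rel ?S"
      using i bot[OF b] by (intro stack_rel_lower[of "{Bot i, Top i}"]) (auto simp: id_diagram_def)
    ultimately show ?thesis using i by simp
  qed
qed

text \<open>Taking outer points recovers each block from its extension, and since blocks are
  nonempty no component is a loop.\<close>

lemma stack_id:
  assumes D: "D \<in> brauer_diagrams m n"
  shows "stack_diagram D (id_diagram n) = D" "stack_loops D (id_diagram n) = 0"
    "stack_diagram (id_diagram m) D = D" "stack_loops (id_diagram m) D = 0"
proof -
  have ne: "{} \<notin> D" using block_nonempty[OF D] by blast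
  then show "stack_diagram D (id_diagram n) = D" "stack_diagram (id_diagram m) D = D"
    by (simp_all add: stack_diagram_def components_stack_id[OF D] components_id_stack[OF D] image_image)
  from ne have "{K \<in> extend_up ` D. outer K = {}} = {}" "{K \<in> extend_down ` D. outer K = {}} = {}"
    by auto
  then show "stack_loops D (id_diagram n) = 0" "stack_loops (id_diagram m) D = 0"
    by (simp_all only: stack_loops_def components_stack_id[OF D] components_id_stack[OF D] card.empty)
qed

section \<open>Zigzag, crossed cups and closed loops\<close>

lemma components_zigzag:
  "components (stack (juxtapose m m (id_diagram m) (coev_diagram m))
                     (juxtapose (m + m) 0 (ev_diagram m) (id_diagram m))) =
   (\<lambda>i. {Lo i, Mid i, Mid (m + i), Mid (m + m + i), Hi i}) ` {..<m}"
  (is "components (stack ?D ?E) = ?K ` _")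
proof (rule components_eq_image[where a = Lo])
  \<comment> \<open>The middle row has three groups of \<open>m\<close> points. Strand
    \<open>i\<close> goes up to \<open>Mid i\<close>, over the cap to \<open>Mid (m + i)\<close>,
    through the cup to \<open>Mid (m + m + i)\<close> and up to \<open>Hi i\<close>.\<close>
  have S: "stack ?D ?E = (\<Union>i<m. {{Lo i, Mid i}, {Mid (m + i), Mid (m + m + i)},
      {Mid i, Mid (m + i)}, {Mid (m + m + i), Hi i}})"
    unfolding stack_def juxtapose_def id_diagram_def coev_diagram_def ev_diagram_def
      image_Un image_image by (auto simp: ac_simps)
  show "\<Union>(stack ?D ?E) = \<Union>(?K ` {..<m})"
    unfolding S by auto
  show "i = j" if "i \<in> {..<m}" "j \<in> {..<m}" "x \<in> ?K i" "x \<in> ?K j" for i j x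
    using that by auto
  show "\<exists>i\<in>{..<m}. e \<subseteq> ?K i" if "e \<in> stack ?D ?E" for e
    using that unfolding S by blast
  show "(Lo i, x) \<in> (edge_rel (stack ?D ?E))\<^sup>*" if i: "i \<in> {..<m}" and x: "x \<in> ?K i" for i x
  proof -
    let ?R = "edge_rel (stack ?D ?E)"
    have e: "{Lo i, Mid i} \<in> stack ?D ?E" "{Mid i, Mid (m + i)} \<in> stack ?D ?E"
      "{Mid (m + i), Mid (m + m + i)} \<in> stack ?D ?E" "{Mid (m + m + i), Hi i} \<in> stack ?D ?E"
      unfolding S using i by blast+
    have 1: "(Lo i, Mid i) \<in> ?R\<^sup>*"
      by (rule r_into_rtrancl, rule edge_relI[OF e(1)]) simp_all
    have 2: "(Lo i, Mid (m + i)) \<in> ?R\<^sup>*"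
      by (rule rtrancl_into_rtrancl[OF 1], rule edge_relI[OF e(2)]) simp_all
    have 3: "(Lo i, Mid (m + m + i)) \<in> ?R\<^sup>*"
      by (rule rtrancl_into_rtrancl[OF 2], rule edge_relI[OF e(3)]) simp_all
    have 4: "(Lo i, Hi i) \<in> ?R\<^sup>*"
      by (rule rtrancl_into_rtrancl[OF 3], rule edge_relI[OF e(4)]) simp_all
    show ?thesis using x 1 2 3 4 by (elim insertE) simp_all
  qed
qed auto

lemma stack_zigzag:
  fixes m :: nat
  defines "D \<equiv> juxtapose m m (id_diagram m) (coev_diagram m)"
    and "E \<equiv> juxtapose (m + m) 0 (ev_diagram m) (id_diagram m)"
  shows "stack_diagram D E = id_diagram m" "stack_loops D E = 0"
proof -
  have o: "outer {Lo i, Mid i, Mid (m + i), Mid (m + m + i), Hi i} = {Bot i, Top i}" for i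
    by (auto simp: outer_def)
  show "stack_diagram D E = id_diagram m"
    unfolding stack_diagram_def D_def E_def components_zigzag image_image o
    by (auto simp: id_diagram_def)
  show "stack_loops D E = 0"
    unfolding stack_loops_def D_def E_def components_zigzag using o by (auto simp: card_eq_0_iff)
qed

lemma components_coev_cross:
  "components (stack (coev_diagram m) (cross_diagram m m)) =
   (\<lambda>i. {Mid i, Mid (m + i), Hi i, Hi (m + i)}) ` {..<m}"
  (is "components (stack ?D ?E) = ?K ` _")
proof (rule components_eq_image[where a = Mid])
  have S: "stack ?D ?E = (\<Union>i<m. {{Mid i, Mid (m + i)}, {Mid i, Hi (m + i)}, {Mid (m + i), Hi i}})"
    unfolding stack_def cross_diagram_def coev_diagram_def image_Un image_image by auto
  show "\<Union>(stack ?D ?E) = \<Union>(?K ` {..<m})"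
    unfolding S by auto
  show "i = j" if "i \<in> {..<m}" "j \<in> {..<m}" "x \<in> ?K i" "x \<in> ?K j" for i j x
    using that by auto
  show "\<exists>i\<in>{..<m}. e \<subseteq> ?K i" if "e \<in> stack ?D ?E" for e
    using that unfolding S by blast
  show "(Mid i, x) \<in> (edge_rel (stack ?D ?E))\<^sup>*" if i: "i \<in> {..<m}" and x: "x \<in> ?K i" for i x
  proof -
    let ?R = "edge_rel (stack ?D ?E)"
    have 1: "(Mid i, Mid (m + i)) \<in> ?R"
      by (rule edge_relI[of "{Mid i, Mid (m + i)}"]) (use i S in auto)
    have 2: "(Mid i, Hi (m + i)) \<in> ?R"
      by (rule edge_relI[of "{Mid i, Hi (m + i)}"]) (use i S in auto)
    have 3: "(Mid (m + i), Hi i) \<in> ?R"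
      by (rule edge_relI[of "{Mid (m + i), Hi i}"]) (use i S in auto)
    show ?thesis using x 1 2 3 by (auto intro: rtrancl_into_rtrancl)
  qed
qed auto

text \<open>Crossing the two halves of the top row only exchanges the ends of each cup, so the
  coevaluation is symmetric.\<close>

lemma stack_coev_cross:
  "stack_diagram (coev_diagram m) (cross_diagram m m) = coev_diagram m"
  "stack_loops (coev_diagram m) (cross_diagram m m) = 0"
proof -
  have o: "outer {Mid i, Mid (m + i), Hi i, Hi (m + i)} = {Top i, Top (m + i)}" for i
    by (auto simp: outer_def)
  show "stack_diagram (coev_diagram m) (cross_diagram m m) = coev_diagram m"
    unfolding stack_diagram_def components_coev_cross image_image o
    by (auto simp: coev_diagram_def)
  show "stack_loops (coev_diagram m) (cross_diagram m m) = 0"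
    unfolding stack_loops_def components_coev_cross using o by (auto simp: card_eq_0_iff)
qed

lemma components_coev_ev:
  "components (stack (coev_diagram m) (ev_diagram m)) = (\<lambda>i. {Mid i, Mid (m + i)}) ` {..<m}"
  (is "components (stack ?D ?E) = ?K ` _")
proof (rule components_eq_image[where a = Mid])
  \<comment> \<open>Cup \<open>i\<close> and cap \<open>i\<close> give the same two-point set, so a
    loop appears as a component with a single edge.\<close>
  have S: "stack ?D ?E = ?K ` {..<m}"
    unfolding stack_def ev_diagram_def coev_diagram_def image_image by auto
  show "\<Union>(stack ?D ?E) = \<Union>(?K ` {..<m})"
    unfolding S by auto
  show "i = j" if "i \<in> {..<m}" "j \<in> {..<m}" "x \<in> ?K i" "x \<in> ?K j" for i j x
    using that by auto
  show "\<exists>i\<in>{..<m}. e \<subseteq> ?K i" if "e \<in> stack ?D ?E" for e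
    using that unfolding S by blast
  show "(Mid i, x) \<in> (edge_rel (stack ?D ?E))\<^sup>*" if i: "i \<in> {..<m}" and x: "x \<in> ?K i" for i x
    by (rule r_into_rtrancl, rule edge_relI[of "?K i"]) (use i x S in auto)
qed auto

text \<open>Every component is a loop without outer points: the composite is the empty diagram, and
  each of the \<open>m\<close> strands contributes one loop.\<close>

lemma stack_coev_ev:
  "stack_diagram (coev_diagram m) (ev_diagram m) = {}"
  "stack_loops (coev_diagram m) (ev_diagram m) = m"
proof -
  have o: "outer {Mid i, Mid (m + i)} = {}" for i
    by (auto simp: outer_def)
  show "stack_diagram (coev_diagram m) (ev_diagram m) = {}"
    unfolding stack_diagram_def components_coev_ev image_image o by auto
  have "{K \<in> (\<lambda>i. {Mid i, Mid (m + i)}) ` {..<m}. outer K = {}} =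
      (\<lambda>i. {Mid i, Mid (m + i)}) ` {..<m}"
    using o by auto
  \<comment> \<open>Distinct indices give distinct loops; the alternative \<open>i = m + j\<close>
    is excluded by \<open>i < m\<close>.\<close>
  moreover have "inj_on (\<lambda>i. {Mid i, Mid (m + i)}) {..<m}"
    by (auto simp: inj_on_def doubleton_eq_iff)
  ultimately show "stack_loops (coev_diagram m) (ev_diagram m) = m"
    unfolding stack_loops_def components_coev_ev by (simp add: card_image)
qed

section \<open>Dimensions in the Brauer category and its envelopes\<close>

lemma sum_basis_mor:
  assumes "finite A" "D \<in> A"
  shows "(\<Sum>F\<in>A. basis_mor D F * h F) = h D"
proof -
  have "(\<Sum>F\<in>A. basis_mor D F * h F) = (\<Sum>F\<in>A. if F = D then h F else 0)"
    by (rule sum.cong) (auto simp: basis_mor_def)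
  then show ?thesis using assms by simp
qed

lemma brauer_comp_basis:
  assumes "D \<in> brauer_diagrams m n" "E \<in> brauer_diagrams n p"
  shows "brauer_comp t m n p (basis_mor E) (basis_mor D) =
    (\<lambda>F. t ^ stack_loops D E * basis_mor (stack_diagram D E) F)"
proof
  fix F
  have "brauer_comp t m n p (basis_mor E) (basis_mor D) F =
    (\<Sum>D'\<in>brauer_diagrams m n. basis_mor D D' * (\<Sum>E'\<in>brauer_diagrams n p. basis_mor E E' *
      (t ^ stack_loops D' E' * basis_mor (stack_diagram D' E') F)))"
    by (simp only: brauer_comp_def sum_distrib_left mult_ac)
  also have "\<dots> = t ^ stack_loops D E * basis_mor (stack_diagram D E) F"
    using assms by (simp only: sum_basis_mor finite_brauer_diagrams)
  finally show "brauer_comp t m n p (basis_mor E) (basis_mor D) F = \<dots>" .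
qed

lemma brauer_tens_basis:
  assumes "D \<in> brauer_diagrams m m'" "E \<in> brauer_diagrams n n'"
  shows "brauer_tens m m' n n' (basis_mor D) (basis_mor E) = basis_mor (juxtapose m m' D E)"
proof
  fix F
  have "brauer_tens m m' n n' (basis_mor D) (basis_mor E) F =
    (\<Sum>D'\<in>brauer_diagrams m m'. basis_mor D D' * (\<Sum>E'\<in>brauer_diagrams n n'. basis_mor E E' *
      basis_mor (juxtapose m m' D' E') F))"
    by (simp only: brauer_tens_def sum_distrib_left mult_ac)
  also have "\<dots> = basis_mor (juxtapose m m' D E) F"
    using assms by (simp only: sum_basis_mor finite_brauer_diagrams)
  finally show "brauer_tens m m' n n' (basis_mor D) (basis_mor E) F = \<dots>" .
qed

text \<open>The middle factor of the transpose is a juxtaposition of identities and drops out; what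
  remains is the zigzag, which straightens without loops.\<close>

lemma transpose_mor_brauer_id:
  "transpose_mor (brauer_cat t) m m (basis_mor (id_diagram m)) = basis_mor (id_diagram m)"
proof -
  \<comment> \<open>The two brackets of the triple tensor product agree by associativity of
    addition.\<close>
  have c: "juxtapose m m (id_diagram m) (coev_diagram m) \<in> brauer_diagrams m (m + m + m)"
    using juxtapose_in[OF id_diagram_in[of m] coev_diagram_in[of m]] by (simp add: add.assoc)
  have e: "juxtapose (m + m) 0 (ev_diagram m) (id_diagram m) \<in> brauer_diagrams (m + m + m) m"
    using juxtapose_in[OF ev_diagram_in[of m] id_diagram_in[of m]] by simp
  show ?thesis
    by (simp add: transpose_mor_def brauer_cat_def Let_def brauer_tens_basis
        brauer_comp_basis[OF c] brauer_comp_basis[OF c e] stack_id[OF c] stack_zigzag)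
qed

text \<open>All idempotents involved are identities. The crossing is absorbed by the coevaluation,
  and closing with the evaluation leaves \<open>m\<close> loops on the empty diagram, the identity
  of the unit.\<close>

lemma dim_cat_karoubi_brauer:
  "dim_cat (karoubi_envelope (brauer_cat t)) (m, basis_mor (id_diagram m)) =
    (\<lambda>F. t ^ m * basis_mor {} F)"
proof -
  let ?C = "brauer_cat t"
  have "transpose_mor ?C m m (basis_mor (id_diagram m)) = basis_mor (id_diagram m)"
    by (rule transpose_mor_brauer_id)
  then show ?thesis
    unfolding dim_cat_def karoubi_envelope_def
    by (simp add: Let_def)
       (simp add: brauer_cat_def brauer_tens_basis brauer_comp_basis
        stack_id[OF coev_diagram_in] stack_id[OF cross_diagram_in] stack_id[OF ev_diagram_in]
        stack_coev_cross stack_coev_ev)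
qed

section \<open>One-term lists in the additive envelope\<close>

definition single_mat :: "'m::zero \<Rightarrow> nat \<Rightarrow> nat \<Rightarrow> 'm" where
  "single_mat f = mat_of 1 1 (\<lambda>_ _. f)"

lemma single_mat_eq_iff [simp]: "single_mat f = single_mat g \<longleftrightarrow> f = g"
  by (auto simp: single_mat_def mat_of_def fun_eq_iff)

text \<open>All lists have length one, so the index arithmetic and the sum over \<open>k\<close>
  collapse: sending \<open>X\<close> to \<open>[X]\<close> preserves the structure strictly.\<close>

lemma additive_envelope_single [simp]:
  fixes C :: "('o, 'm::ab_group_add) rsm_cat"
  defines "A \<equiv> additive_envelope C"
  shows "comp_mor A [X] [Y] [Z] (single_mat g) (single_mat f) = single_mat (comp_mor C X Y Z g f)"
    "tens A [X] [X'] [Y] [Y'] (single_mat f) (single_mat g) = single_mat (tens C X X' Y Y' f g)"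
    "ident A [X] = single_mat (ident C X)"
    "unit_obj A = [unit_obj C]"
    "tens_obj A [X] [Y] = [tens_obj C X Y]"
    "dual A [X] = [dual C X]"
    "symm A [X] [Y] = single_mat (symm C X Y)"
    "ev A [X] = single_mat (ev C X)"
    "coev A [X] = single_mat (coev C X)"
  by (auto simp: A_def additive_envelope_def single_mat_def mat_of_def add_tens_obj_def
      Let_def fun_eq_iff)

lemma transpose_mor_additive_single [simp]:
  "transpose_mor (additive_envelope C) [X] [Y] (single_mat f) = single_mat (transpose_mor C X Y f)"
  by (simp add: transpose_mor_def Let_def)

text \<open>The dimension is composed of structure morphisms between one-term lists, so it can be
  computed before passing to matrices.\<close>

lemma dim_cat_karoubi_additive_single:
  "dim_cat (karoubi_envelope (additive_envelope C)) ([X], single_mat e) =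
    single_mat (dim_cat (karoubi_envelope C) (X, e))"
  unfolding dim_cat_def karoubi_envelope_def by (simp add: Let_def)

lemma dim_cat_RepO_of_brauer:
  "dim_cat (RepO t) (RepO_of_brauer t m) = single_mat (\<lambda>F. t ^ m * basis_mor {} F)"
  unfolding RepO_def RepO_of_brauer_def additive_envelope_single dim_cat_karoubi_additive_single
  by (simp add: brauer_cat_def flip: dim_cat_karoubi_brauer)

lemma end_unit_of_RepO: "end_unit_of (RepO c) d = single_mat (\<lambda>F. d * basis_mor {} F)"
  by (auto simp: end_unit_of_def RepO_def karoubi_envelope_def additive_envelope_def
      brauer_cat_def single_mat_def mat_of_def id_diagram_def fun_eq_iff)

text \<open>The coefficient at the empty diagram determines the scalar, so the definite description
  has a unique solution.\<close>

lemma end_unit_scalar_RepO [simp]: "end_unit_scalar (RepO t) (end_unit_of (RepO t) c) = c"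
proof -
  have "end_unit_of (RepO t) c = end_unit_of (RepO t) d \<longleftrightarrow> c = d" for d
    unfolding end_unit_of_RepO single_mat_eq_iff by (auto simp: basis_mor_def fun_eq_iff)
  then show ?thesis by (simp add: end_unit_scalar_def)
qed

lemma dim_cat_X_gen: "dim_cat (RepO t) (X_gen t) = end_unit_of (RepO t) t"
  by (simp add: X_gen_def dim_cat_RepO_of_brauer end_unit_of_RepO)

section \<open>The cocycles\<close>

text \<open>This is \<open>pi powr (x / 2) / Gamma (x / 2 + 1)\<close>, the unit ball volume in
  dimension \<open>x\<close>; the factor \<open>2 / x\<close> is the integral of
  \<open>u powr (x / 2 - 1)\<close> over the unit interval.\<close>

lemma V_ball_eq:
  assumes "x > 0"
  shows "V_ball x = pi powr (x / 2) / Gamma (x / 2) * (2 / x)"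
proof -
  define c where "c = pi powr (x / 2) / Gamma (x / 2)"
  have c: "c \<ge> 0" using assms by (simp add: c_def Gamma_real_pos less_imp_le)
  \<comment> \<open>The exponent exceeds \<open>-1\<close> because \<open>x > 0\<close>, so the
    singularity at 0 is integrable.\<close>
  have "((\<lambda>u. u powr (x / 2 - 1)) has_integral (2 / x)) {0..1}"
    using has_integral_powr_from_0[of "x / 2 - 1" 1] assms by simp
  then have "((\<lambda>u. c * u powr (x / 2 - 1)) has_integral (c * (2 / x))) {0<..<1}"
    unfolding has_integral_Icc_iff_Ioo by (rule has_integral_mult_right)
  then have I: "(\<integral>\<^sup>+u. ennreal (c * u powr (x / 2 - 1)) * indicator {0<..<1} u \<partial>lborel)
      = ennreal (c * (2 / x))"
    using c by (intro nn_integral_has_integral_lebesgue') auto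
  have "emeasure (radial_measure x) {0<..<1} =
     (\<integral>\<^sup>+u. ennreal (c * u powr (x / 2 - 1)) * indicator {0<..<1} u \<partial>restrict_space lborel {0<..})"
    unfolding radial_measure_def c_def[symmetric]
    by (intro emeasure_density) (auto simp: sets_restrict_space intro!: measurable_restrict_space1 image_eqI)
  \<comment> \<open>The interval lies in the positive half-line, so the restriction of Lebesgue
    measure is invisible.\<close>
  also have "\<dots> = (\<integral>\<^sup>+u. ennreal (c * u powr (x / 2 - 1)) * indicator {0<..<1} u \<partial>lborel)"
    by (subst nn_integral_restrict_space) (auto intro!: nn_integral_cong split: split_indicator)
  finally show ?thesis
    using c assms I by (simp add: V_ball_def measure_def c_def)
qed

text \<open>The ratio of volumes is \<open>R_cocycle x r\<close> times the ratio of
  \<open>2 / (x + 2 * r)\<close> and \<open>2 / x\<close>; the powers of \<open>pi\<close> and the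
  Gamma values cancel.\<close>

lemma R_div_T_cocycle:
  assumes "x > 0" "r \<ge> 0"
  shows "R_cocycle x r / T_cocycle x r = (x + 2 * r) / x"
proof -
  define g h where "g = Gamma (x / 2)" and "h = Gamma (x / 2 + r)"
  have pos: "g > 0" "h > 0"
    using assms by (simp_all add: g_def h_def Gamma_real_pos)
  have half: "(x + 2 * r) / 2 = x / 2 + r" by simp
  have V: "V_ball (x + 2 * r) = pi powr (x / 2) * pi powr r / h * (2 / (x + 2 * r))"
    using assms V_ball_eq[of "x + 2 * r"] unfolding half powr_add h_def by simp
  have W: "V_ball x = pi powr (x / 2) / g * (2 / x)"
    using assms by (simp add: V_ball_eq g_def)
  have "x + 2 * r \<noteq> 0" "pi powr (x / 2) \<noteq> 0" "pi powr r \<noteq> 0"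
    using assms by auto
  then show ?thesis
    unfolding R_cocycle_def T_cocycle_def V W g_def[symmetric] h_def[symmetric]
    using pos assms by (simp add: divide_simps)
qed

theorem proposition7p1:
  shows "(\<forall>t :: complex. dim_cat (RepO t) (X_gen t) = end_unit_of (RepO t) t) \<and>
    (\<forall>x r :: real. x > 0 \<longrightarrow> r \<ge> 0 \<longrightarrow>
      complex_of_real (R_cocycle x r / T_cocycle x r) =
        (let y = complex_of_real (x + 2 * r); z = complex_of_real x
         in end_unit_scalar (RepO y) (dim_cat (RepO y) (X_gen y)) /
            end_unit_scalar (RepO z) (dim_cat (RepO z) (X_gen z))))"
  \<comment> \<open>Each category has its own parameter as the dimension of its generator, so the
    right-hand side is \<open>(x + 2 * r) / x\<close>.\<close>
  by (simp add: dim_cat_X_gen R_div_T_cocycle Let_def)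

end
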